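(* Let $n$ be an even positive integer and let $(a_{i,j})_{1\le i,j\le n}$ be a doubly indexed family of elements of $R$ with $a_{i,j}=-a_{j,i}$ for all $i$ and $j$. Let $A=(a_{i,j})_{1\le i,j\le n}$, and let $C=(C_{i,j})_{2\le i,j\le n}$ be the $(n-1)\times(n-1)$ matrix with $$C_{i,j}=\begin{cases}a_{i,j} & \text{if } i+j \text{ is even},\\ a_{i,j}-a_{1,i}a_{1,j} & \text{if } i+j \text{ is odd}.\end{cases}$$ Then $$\det C=-2\operatorname{Pf}_e(A)\operatorname{Pf}_o(A).$$
   Context: $R$ is a commutative ring containing $\mathbb{Q}$; in the paper the $a_{i,j}$ are thought of as indeterminates (subject to the stated relations). The Pfaffian of the skew-symmetric matrix $A$ is $$\operatorname{Pf}(A)=\sum_m \operatorname{sgn} m\prod_{(i,j)\in m}a_{i,j},$$ where the sum is over all perfect matchings $m$ of $\{1,2,\dots,n\}$, each matched pair is written $(i,j)$ with $i<j$, and $\operatorname{sgn} m$ is the usual sign of a perfect matching, i.e. $(-1)^{\mathrm{cr}(m)}$ where $\mathrm{cr}(m)$ is the number of crossings (pairs $(i,j),(k,l)\in m$ with $i<k<j<l$); thus the term $a_{1,n}a_{2,n-1}\cdots a_{n/2,n/2+1}$ has coefficient $+1$ and $\operatorname{Pf}(A)^2=\det A$. $\operatorname{Pf}_e(A)$ denotes the sum of all terms $\operatorname{sgn} m\prod_{(i,j)\in m}a_{i,j}$ over perfect matchings $m$ in which $1$ is matched to an even number $k$ (the terms containing $a_{1,k}$ with $k$ even), and $\operatorname{Pf}_o(A)$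 denotes the sum of all such terms over perfect matchings in which $1$ is matched to an odd number $k$. *)

theory Defs
  imports "Jordan_Normal_Form.Determinant"
begin

text \<open>A matched pair is represented by the ordered pair of its elements, the smaller one first.\<close>

definition perfect_matchings :: "nat \<Rightarrow> (nat \<times> nat) set set" where
  "perfect_matchings n =
     {m. m \<subseteq> {(i, j). i \<in> {1..n} \<and> j \<in> {1..n} \<and> i < j} \<and>
         (\<forall>v\<in>{1..n}. \<exists>!p. p \<in> m \<and> (v = fst p \<or> v = snd p))}"

definition crossings :: "(nat \<times> nat) set \<Rightarrow> nat" where
  "crossings m =
     card {((i, j), (k, l)) | i j k l. (i, j) \<in> m \<and> (k, l) \<in> m \<and> i < k \<and> k < j \<and> j < l}"

definition matching_term :: "(nat \<Rightarrow> nat \<Rightarrow> 'a) \<Rightarrow> (nat \<times> nat) set \<Rightarrow> 'a :: comm_ring_1" where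
  "matching_term a m = (-1) ^ crossings m * (\<Prod>(i, j)\<in>m. a i j)"

definition Pf_e :: "nat \<Rightarrow> (nat \<Rightarrow> nat \<Rightarrow> 'a) \<Rightarrow> 'a :: comm_ring_1" where
  "Pf_e n a = (\<Sum>m | m \<in> perfect_matchings n \<and> (\<exists>k. (1, k) \<in> m \<and> even k). matching_term a m)"

definition Pf_o :: "nat \<Rightarrow> (nat \<Rightarrow> nat \<Rightarrow> 'a) \<Rightarrow> 'a :: comm_ring_1" where
  "Pf_o n a = (\<Sum>m | m \<in> perfect_matchings n \<and> (\<exists>k. (1, k) \<in> m \<and> odd k). matching_term a m)"

text \<open>The matrix \<open>C\<close> has its rows and columns indexed by \<open>2, \<dots>, n\<close>,
  whereas those of the type \<open>mat\<close> are indexed from \<open>0\<close>; hence the shift by \<open>2\<close>.\<close>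

definition C_entry :: "(nat \<Rightarrow> nat \<Rightarrow> 'a) \<Rightarrow> nat \<Rightarrow> nat \<Rightarrow> 'a :: comm_ring_1" where
  "C_entry a i j = (if even (i + j) then a i j else a i j - a 1 i * a 1 j)"

definition C_mat :: "nat \<Rightarrow> (nat \<Rightarrow> nat \<Rightarrow> 'a) \<Rightarrow> 'a :: comm_ring_1 mat" where
  "C_mat n a = mat (n - 1) (n - 1) (\<lambda>(r, s). C_entry a (r + 2) (s + 2))"

end

theory Submission
  imports Defs
begin

text \<open>
  Write \<open>S = {2..n}\<close>, and split the first row of \<open>A\<close> into the vectors \<open>u\<close> and \<open>v\<close> on \<open>S\<close> that
  carry its entries in even and in odd columns. An entry of \<open>C\<close> has a correction term exactly
  when one index is even and the other odd, so \<open>C\<close> is the matrix \<open>B = A|\<^sub>S\<close> minus the symmetric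
  rank-two matrix \<open>v u\<^sup>T + u v\<^sup>T\<close>. A Schur complement turns this perturbation into a border:
  the square matrix of odd size \<open>n + 1\<close>

    \<open>H = [0, -1, u; -1, 0, v; -u, -v, B]\<close>

  has determinant \<open>- det C\<close> (\<open>set_minor_bordered\<close>). It fails to be skew-symmetric
  in the entry \<open>-1\<close> at position \<open>(1, 0)\<close> alone. Replacing that entry by \<open>1\<close> gives a
  skew-symmetric matrix \<open>G\<close> of odd size, whose determinant vanishes; hence \<open>det H\<close> is
  \<open>(1 - (-1))\<close> times the minor of \<open>G\<close> with rows \<open>{0} \<union> S\<close> and columns \<open>{1} \<union> S\<close>.

  That minor is a product of two Pfaffians. In general, if \<open>T\<close> has odd size, the minor of a
  skew-symmetric matrix with rows \<open>T \<union> {p}\<close> and columns \<open>T \<union> {q}\<close> equals \<open>Pf(T \<union> {p}) Pf(T \<union> {q})\<close>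
  (\<open>set_minor_eq_pfaffians\<close>). The proof expands the minor along row \<open>p\<close> and column \<open>q\<close>; the
  smaller minors that remain have rows \<open>T - {k}\<close> and columns \<open>T - {y}\<close>, so by induction they are
  products \<open>Pf(T - {k}) Pf(T - {y})\<close>, and the double sum factors into the expansions of the two
  Pfaffians along \<open>p\<close> and \<open>q\<close>. The argument only cancels the factor \<open>2\<close>, so it works over a ring with
  zero divisors. Applied to \<open>G\<close>, the two factors are the Pfaffians of \<open>A\<close> with first row replaced
  by \<open>u\<close> and by \<open>v\<close>, which are \<open>Pf\<^sub>e\<close> and \<open>Pf\<^sub>o\<close>.
\<close>

section \<open>Minors indexed by finite sets\<close>

text \<open>Rows and columns are addressed by the elements of \<open>X\<close> and \<open>Y\<close> rather than by positions, so
  that repeated Laplace expansion only removes elements and never shifts indices. The order of the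
  indices survives solely in the signs, through \<open>rank\<close> below.\<close>

definition set_minor :: "(nat \<Rightarrow> nat \<Rightarrow> 'a :: comm_ring_1) \<Rightarrow> nat set \<Rightarrow> nat set \<Rightarrow> 'a" where
  "set_minor f X Y = det (mat (card X) (card Y)
     (\<lambda>(r, c). f (sorted_list_of_set X ! r) (sorted_list_of_set Y ! c)))"

definition rank :: "nat set \<Rightarrow> nat \<Rightarrow> nat" where
  "rank X x = card {z \<in> X. z < x}"

lemma rank_nth:
  assumes "finite X" "r < card X"
  shows "rank X (sorted_list_of_set X ! r) = r"
proof -
  let ?l = "sorted_list_of_set X"
  have s: "sorted_wrt (<) ?l" "length ?l = card X" "set ?l = X" "distinct ?l"
    using assms by auto
  have lt: "?l ! i < ?l ! j \<longleftrightarrow> i < j" if "i < card X" "j < card X" for i j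
    using s that by (metis linorder_neqE_nat not_less_iff_gr_or_eq sorted_wrt_nth_less)
  have "{z \<in> X. z < ?l ! r} = (\<lambda>i. ?l ! i) ` {..<r}"
  proof (intro equalityI subsetI)
    fix z assume "z \<in> {z \<in> X. z < ?l ! r}"
    then have z: "z \<in> set ?l" "z < ?l ! r" using s by auto
    then obtain i where "i < card X" "z = ?l ! i" using s(2) by (metis in_set_conv_nth)
    then show "z \<in> (\<lambda>i. ?l ! i) ` {..<r}" using lt z assms by auto
  next
    fix z assume "z \<in> (\<lambda>i. ?l ! i) ` {..<r}"
    then obtain i where "i < r" "z = ?l ! i" by auto
    then show "z \<in> {z \<in> X. z < ?l ! r}" using lt assms s
      by (metis (mono_tags, lifting) mem_Collect_eq nth_mem order_less_trans)
  qed
  moreover have "inj_on (\<lambda>i. ?l ! i) {..<r}"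
    using s assms by (auto simp: inj_on_def nth_eq_iff_index_eq)
  ultimately show ?thesis unfolding rank_def by (simp add: card_image)
qed

lemma sorted_list_of_set_Diff_nth:
  assumes "finite X" "r < card X" "i < card X - 1"
  shows "sorted_list_of_set (X - {sorted_list_of_set X ! r}) ! i =
         sorted_list_of_set X ! (if i < r then i else Suc i)"
proof -
  let ?l = "sorted_list_of_set X"
  have len: "length ?l = card X" using assms by auto
  have split: "?l = take r ?l @ ?l ! r # drop (Suc r) ?l"
    using assms len by (simp add: id_take_nth_drop)
  have "distinct ?l" by simp
  then have "?l ! r \<notin> set (take r ?l)"
    using split by (metis distinct_append IntI empty_iff list.set_intros(1))
  then have "remove1 (?l ! r) ?l = take r ?l @ drop (Suc r) ?l"
    using split by (metis remove1_append remove1.simps(2))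
  then have "sorted_list_of_set (X - {?l ! r}) = take r ?l @ drop (Suc r) ?l"
    using assms by (simp add: sorted_list_of_set_remove)
  then show ?thesis using assms len by (auto simp: nth_append min_def)
qed

lemma bij_betw_sorted_list:
  "finite X \<Longrightarrow> bij_betw (\<lambda>c. sorted_list_of_set X ! c) {..<card X} X"
  by (rule bij_betw_nth) auto

text \<open>Laplace expansion along the row \<open>x\<close>: the element \<open>x\<close> sits at position \<open>rank X x\<close>, and removing
  it from \<open>X\<close> deletes just this entry of the sorted list.\<close>

lemma set_minor_expand_row:
  assumes X: "finite X" and Y: "finite Y" and card: "card X = card Y" and x: "x \<in> X"
  shows "set_minor f X Y =
    (\<Sum>y\<in>Y. (-1) ^ (rank X x + rank Y y) * f x y * set_minor f (X - {x}) (Y - {y}))"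
proof -
  let ?xs = "sorted_list_of_set X" and ?ys = "sorted_list_of_set Y"
  let ?A = "mat (card X) (card Y) (\<lambda>(r, c). f (?xs ! r) (?ys ! c))"
  obtain r where r: "r < card X" "x = ?xs ! r"
    using x X by (metis in_set_conv_nth length_sorted_list_of_set set_sorted_list_of_set)
  have A: "?A \<in> carrier_mat (card X) (card X)" using card by auto
  have minor: "det (mat_delete ?A r c) = set_minor f (X - {x}) (Y - {?ys ! c})"
    if c: "c < card Y" for c
  proof -
    have yc: "?ys ! c \<in> Y" using bij_betw_sorted_list[OF Y] c
      by (auto simp: bij_betw_def)
    show ?thesis
      unfolding set_minor_def
      by (rule arg_cong[where f = det])
        (use x yc r c X Y card in \<open>auto simp: mat_delete_def sorted_list_of_set_Diff_nth card_Diff_singleton intro!: eq_matI\<close>)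
  qed
  have "set_minor f X Y = (\<Sum>c<card Y. ?A $$ (r, c) * cofactor ?A r c)"
    unfolding set_minor_def using laplace_expansion_row[OF A r(1)] card by simp
  also have "\<dots> = (\<Sum>c<card Y. (\<lambda>y. (-1) ^ (rank X x + rank Y y) * f x y
                      * set_minor f (X - {x}) (Y - {y})) (?ys ! c))"
    using r X Y by (intro sum.cong) (auto simp: cofactor_def minor rank_nth)
  also have "\<dots> = (\<Sum>y\<in>Y. (-1) ^ (rank X x + rank Y y) * f x y
                      * set_minor f (X - {x}) (Y - {y}))"
    by (rule sum.reindex_bij_betw[OF bij_betw_sorted_list[OF Y]])
  finally show ?thesis .
qed

lemma set_minor_transpose:
  assumes "card X = card Y"
  shows "set_minor f X Y = set_minor (\<lambda>i j. f j i) Y X"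
proof -
  let ?A = "mat (card X) (card Y) (\<lambda>(r, c). f (sorted_list_of_set X ! r) (sorted_list_of_set Y ! c))"
  have "?A \<in> carrier_mat (card X) (card X)" using assms by auto
  then have "set_minor f X Y = det (transpose_mat ?A)"
    unfolding set_minor_def by (simp add: det_transpose)
  also have "transpose_mat ?A = mat (card Y) (card X)
      (\<lambda>(r, c). f (sorted_list_of_set X ! c) (sorted_list_of_set Y ! r))"
    by (rule eq_matI) auto
  finally show ?thesis unfolding set_minor_def by simp
qed

lemma set_minor_expand_column:
  assumes "finite X" "finite Y" "card X = card Y" "y \<in> Y"
  shows "set_minor f X Y =
    (\<Sum>x\<in>X. (-1) ^ (rank X x + rank Y y) * f x y * set_minor f (X - {x}) (Y - {y}))"
proof -
  have "set_minor f X Y = set_minor (\<lambda>i j. f j i) Y X"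
    by (rule set_minor_transpose) fact
  also have "\<dots> = (\<Sum>x\<in>X. (-1) ^ (rank Y y + rank X x) * f x y
      * set_minor (\<lambda>i j. f j i) (Y - {y}) (X - {x}))"
    by (rule set_minor_expand_row) (use assms in auto)
  also have "\<dots> = (\<Sum>x\<in>X. (-1) ^ (rank X x + rank Y y) * f x y
      * set_minor f (X - {x}) (Y - {y}))"
    using assms
    by (intro sum.cong) (auto simp: add.commute set_minor_transpose[of "X - _" _ f] card_Diff_singleton)
  finally show ?thesis .
qed

lemma set_minor_cong:
  assumes "finite X" "finite Y" "\<And>x y. x \<in> X \<Longrightarrow> y \<in> Y \<Longrightarrow> f x y = g x y"
  shows "set_minor f X Y = set_minor g X Y"
proof -
  have "sorted_list_of_set X ! r \<in> X" if "r < card X" for r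
    using bij_betw_sorted_list[OF assms(1)] that by (auto simp: bij_betw_def)
  moreover have "sorted_list_of_set Y ! r \<in> Y" if "r < card Y" for r
    using bij_betw_sorted_list[OF assms(2)] that by (auto simp: bij_betw_def)
  ultimately show ?thesis
    unfolding set_minor_def using assms(3) by (intro arg_cong[where f = det] eq_matI) auto
qed

lemma set_minor_change_row:
  assumes "finite X" "finite Y" "card X = card Y" "x \<in> X"
    and eq: "\<And>x' y. x' \<in> X - {x} \<Longrightarrow> y \<in> Y \<Longrightarrow> f x' y = g x' y"
  shows "set_minor f X Y - set_minor g X Y =
    (\<Sum>y\<in>Y. (-1) ^ (rank X x + rank Y y) * (f x y - g x y) * set_minor g (X - {x}) (Y - {y}))"
proof -
  have "set_minor f (X - {x}) (Y - {y}) = set_minor g (X - {x}) (Y - {y})" for y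
    by (rule set_minor_cong) (use assms in auto)
  then show ?thesis
    by (simp add: set_minor_expand_row[OF assms(1-4)] sum_subtractf[symmetric] algebra_simps)
qed

text \<open>Transposing a skew-symmetric matrix negates each of its rows, an odd number of them, so the
  determinant is its own negative.\<close>

lemma set_minor_skew_odd:
  fixes a :: "nat \<Rightarrow> nat \<Rightarrow> 'a :: comm_ring_1"
  assumes two: "\<And>x :: 'a. x + x = 0 \<Longrightarrow> x = 0"
    and T: "finite T" "odd (card T)"
    and skew: "\<And>i j. i \<in> T \<Longrightarrow> j \<in> T \<Longrightarrow> a i j = - a j i"
  shows "set_minor a T T = 0"
proof -
  let ?A = "mat (card T) (card T) (\<lambda>(r, c). a (sorted_list_of_set T ! r) (sorted_list_of_set T ! c))"
  have "set_minor a T T = set_minor (\<lambda>i j. a j i) T T"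
    by (rule set_minor_transpose) simp
  also have "\<dots> = set_minor (\<lambda>i j. - a i j) T T"
    by (rule set_minor_cong) (use T in \<open>auto intro: skew\<close>)
  also have "\<dots> = det ((-1) \<cdot>\<^sub>m ?A)"
    unfolding set_minor_def by (rule arg_cong[where f = det]) (auto intro!: eq_matI)
  also have "\<dots> = - set_minor a T T"
    using T by (simp add: set_minor_def)
  finally have "set_minor a T T + set_minor a T T = 0"
    by (simp only: eq_neg_iff_add_eq_0)
  then show ?thesis by (rule two)
qed

section \<open>Pfaffians of finite sets of indices\<close>

definition matchings_on :: "nat set \<Rightarrow> (nat \<times> nat) set set" where
  "matchings_on S =
     {m. m \<subseteq> {(i, j). i \<in> S \<and> j \<in> S \<and> i < j} \<and>
         (\<forall>v\<in>S. \<exists>!p. p \<in> m \<and> (v = fst p \<or> v = snd p))}"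

definition pfaffian :: "(nat \<Rightarrow> nat \<Rightarrow> 'a :: comm_ring_1) \<Rightarrow> nat set \<Rightarrow> 'a" where
  "pfaffian a S = (\<Sum>m\<in>matchings_on S. matching_term a m)"

lemma matchings_on_subset: "m \<in> matchings_on S \<Longrightarrow> m \<subseteq> S \<times> S"
  unfolding matchings_on_def by auto

lemma matchings_on_finite: "finite S \<Longrightarrow> m \<in> matchings_on S \<Longrightarrow> finite m"
  using matchings_on_subset finite_subset by blast

lemma finite_matchings_on: "finite S \<Longrightarrow> finite (matchings_on S)"
  by (rule finite_subset[of _ "Pow (S \<times> S)"]) (auto dest: matchings_on_subset)

lemma matchings_onD:
  assumes "m \<in> matchings_on S" "(i, j) \<in> m"
  shows "i \<in> S" "j \<in> S" "i < j"
  using assms unfolding matchings_on_def by auto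

lemma matchings_on_unique:
  assumes "m \<in> matchings_on S" "p \<in> m" "q \<in> m" "v = fst p \<or> v = snd p" "v = fst q \<or> v = snd q"
  shows "p = q"
proof -
  have "v \<in> S" using assms matchings_on_subset by fastforce
  then show ?thesis using assms unfolding matchings_on_def by blast
qed

lemma pfaffian_empty: "pfaffian a {} = 1"
proof -
  have "matchings_on {} = {{}}" unfolding matchings_on_def by auto
  then show ?thesis by (simp add: pfaffian_def matching_term_def crossings_def)
qed

lemma matching_term_cong:
  assumes "m \<in> matchings_on S" "\<And>i j. i \<in> S \<Longrightarrow> j \<in> S \<Longrightarrow> i < j \<Longrightarrow> a i j = b i j"
  shows "matching_term a m = matching_term b m"
proof -
  have "a (fst p) (snd p) = b (fst p) (snd p)" if "p \<in> m" for p
    using matchings_onD[OF assms(1), of "fst p" "snd p"] that by (intro assms(2)) auto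
  then have "(\<Prod>p\<in>m. a (fst p) (snd p)) = (\<Prod>p\<in>m. b (fst p) (snd p))"
    by (intro prod.cong) auto
  then show ?thesis unfolding matching_term_def by (simp add: case_prod_unfold)
qed

lemma pfaffian_cong:
  assumes "\<And>i j. i \<in> S \<Longrightarrow> j \<in> S \<Longrightarrow> i < j \<Longrightarrow> a i j = b i j"
  shows "pfaffian a S = pfaffian b S"
  unfolding pfaffian_def by (intro sum.cong refl matching_term_cong assms)

lemma sum_over_matching:
  fixes h :: "nat \<Rightarrow> nat"
  assumes S: "finite S" and m: "m \<in> matchings_on S"
  shows "(\<Sum>v\<in>S. h v) = (\<Sum>p\<in>m. h (fst p) + h (snd p))"
proof -
  have "S = (\<Union>p\<in>m. {fst p, snd p})"
  proof (intro equalityI subsetI)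
    fix v assume "v \<in> S"
    then obtain p where "p \<in> m" "v = fst p \<or> v = snd p"
      using m unfolding matchings_on_def by blast
    then show "v \<in> (\<Union>p\<in>m. {fst p, snd p})" by blast
  next
    fix v assume "v \<in> (\<Union>p\<in>m. {fst p, snd p})"
    then obtain p where "p \<in> m" "v = fst p \<or> v = snd p" by blast
    then show "v \<in> S" using matchings_onD[OF m, of "fst p" "snd p"] by auto
  qed
  then have "(\<Sum>v\<in>S. h v) = (\<Sum>v\<in>(\<Union>p\<in>m. {fst p, snd p}). h v)" by simp
  also have "\<dots> = (\<Sum>p\<in>m. \<Sum>v\<in>{fst p, snd p}. h v)"
  proof (rule sum.UNION_disjoint)
    show "\<forall>p\<in>m. \<forall>q\<in>m. p \<noteq> q \<longrightarrow> {fst p, snd p} \<inter> {fst q, snd q} = {}"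
      using matchings_on_unique[OF m] by blast
  qed (use matchings_on_finite[OF S m] in auto)
  also have "\<dots> = (\<Sum>p\<in>m. h (fst p) + h (snd p))"
  proof (rule sum.cong[OF refl])
    fix p assume "p \<in> m"
    then have "fst p \<noteq> snd p" using matchings_onD(3)[OF m, of "fst p" "snd p"] by auto
    then show "(\<Sum>v\<in>{fst p, snd p}. h v) = h (fst p) + h (snd p)" by simp
  qed
  finally show ?thesis .
qed

text \<open>
  Each pair of \<open>m\<close> has none, one or two endpoints strictly between \<open>i\<close> and \<open>k\<close>, and it crosses
  \<open>(i, k)\<close> exactly in the case of one endpoint. Since every element of \<open>S - {i, k}\<close> is an endpoint
  of one pair, the number of crossings of \<open>(i, k)\<close> has the parity of the number of
  elements in between, which no longer depends on \<open>m\<close>. This makes the Pfaffian expandable.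
\<close>

lemma crossings_insert_parity:
  assumes S: "finite S" and m: "m \<in> matchings_on (S - {i, k})" and ik: "i < k"
  shows "even (crossings (insert (i, k) m)) \<longleftrightarrow> even (crossings m + card {v \<in> S. i < v \<and> v < k})"
proof -
  let ?Q = "\<lambda>m. {((i, j), (k, l)) | i j k l. (i, j) \<in> m \<and> (k, l) \<in> m \<and> i < k \<and> k < j \<and> j < (l :: nat)}"
  have fm: "finite m" using matchings_on_finite[OF _ m] S by simp
  (* Crossings are ordered pairs of edges; A holds the edges that cross (i, k) from
     the right and B those that cross it from the left. *)
  define A where "A = {p \<in> m. i < fst p \<and> fst p < k \<and> k < snd p}"
  define B where "B = {p \<in> m. fst p < i \<and> i < snd p \<and> snd p < k}"
  have Q: "?Q (insert (i, k) m) = ?Q m \<union> (Pair (i, k) ` A \<union> (\<lambda>p. (p, (i, k))) ` B)"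
    using ik unfolding A_def B_def by (auto simp: image_iff)
  have notin: "(i, k) \<notin> m" using matchings_onD(1)[OF m, of i k] by auto
  have fQ: "finite (?Q m)"
    by (rule finite_subset[of _ "m \<times> m"]) (use fm in auto)
  have fA: "finite A" "finite B" unfolding A_def B_def using fm by auto
  have "card (Pair (i, k) ` A \<union> (\<lambda>p. (p, (i, k))) ` B) = card A + card B"
    using fA notin
    by (subst card_Un_disjoint) (auto simp: card_image inj_on_def A_def B_def)
  moreover have "?Q m \<inter> (Pair (i, k) ` A \<union> (\<lambda>p. (p, (i, k))) ` B) = {}"
    using notin by auto
  ultimately have cr: "crossings (insert (i, k) m) = crossings m + (card A + card B)"
    unfolding crossings_def Q using fQ fA by (subst card_Un_disjoint) auto
  define h where "h v = (of_bool (i < v \<and> v < k) :: nat)" for v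
  have "card {v \<in> S. i < v \<and> v < k} = (\<Sum>v\<in>S - {i, k}. h v)"
  proof -
    have "{v \<in> S. i < v \<and> v < k} = {v \<in> S - {i, k}. i < v \<and> v < k}" by auto
    also have "card \<dots> = (\<Sum>v\<in>S - {i, k}. h v)"
      unfolding h_def of_bool_def using S by (subst sum.If_cases) (auto intro!: arg_cong[where f = card])
    finally show ?thesis .
  qed
  also have "\<dots> = (\<Sum>p\<in>m. h (fst p) + h (snd p))"
    using sum_over_matching[OF _ m] S by simp
  finally have between: "card {v \<in> S. i < v \<and> v < k} = (\<Sum>p\<in>m. h (fst p) + h (snd p))" .
  have cA: "card A = (\<Sum>p\<in>m. of_bool (i < fst p \<and> fst p < k \<and> k < snd p))"
    unfolding A_def of_bool_def using fm by (subst sum.If_cases) (auto intro!: arg_cong[where f = card])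
  have cB: "card B = (\<Sum>p\<in>m. of_bool (fst p < i \<and> i < snd p \<and> snd p < k))"
    unfolding B_def of_bool_def using fm by (subst sum.If_cases) (auto intro!: arg_cong[where f = card])
  have "even (card A + card B + card {v \<in> S. i < v \<and> v < k})"
    unfolding cA cB between sum.distrib[symmetric]
  proof (rule dvd_sum)
    fix p assume "p \<in> m"
    then have "fst p < snd p" "fst p \<noteq> i" "fst p \<noteq> k" "snd p \<noteq> i" "snd p \<noteq> k"
      using matchings_onD[OF m, of "fst p" "snd p"] by auto
    then show "even (of_bool (i < fst p \<and> fst p < k \<and> k < snd p)
       + of_bool (fst p < i \<and> i < snd p \<and> snd p < k) + (h (fst p) + h (snd p)))"
      using ik unfolding h_def by (auto simp: of_bool_def)
  qed
  then show ?thesis unfolding cr by auto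
qed

lemma matchings_on_insert:
  assumes m: "m \<in> matchings_on (S - {i, k})" and ik: "i \<in> S" "k \<in> S" "i < k"
  shows "insert (i, k) m \<in> matchings_on S"
proof -
  have m1: "m \<subseteq> {(x, y). x \<in> S - {i, k} \<and> y \<in> S - {i, k} \<and> x < y}"
    and m2: "\<And>v. v \<in> S - {i, k} \<Longrightarrow> \<exists>!p. p \<in> m \<and> (v = fst p \<or> v = snd p)"
    using m unfolding matchings_on_def by auto
  have "\<exists>!p. p \<in> insert (i, k) m \<and> (v = fst p \<or> v = snd p)" if v: "v \<in> S" for v
  proof (cases "v = i \<or> v = k")
    case True
    show ?thesis by (rule ex1I[of _ "(i, k)"]) (use True m1 ik in auto)
  next
    case False
    then have "(p \<in> insert (i, k) m \<and> (v = fst p \<or> v = snd p)) \<longleftrightarrow> (p \<in> m \<and> (v = fst p \<or> v = snd p))" for p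
      by auto
    then show ?thesis using m2[of v] v False by simp
  qed
  moreover have "insert (i, k) m \<subseteq> {(x, y). x \<in> S \<and> y \<in> S \<and> x < y}"
    using m1 ik by auto
  ultimately show ?thesis unfolding matchings_on_def by simp
qed

lemma matchings_on_remove:
  assumes m: "m \<in> matchings_on S" and ik: "(i, k) \<in> m"
  shows "m - {(i, k)} \<in> matchings_on (S - {i, k})"
proof -
  have m2: "\<And>v. v \<in> S \<Longrightarrow> \<exists>!p. p \<in> m \<and> (v = fst p \<or> v = snd p)"
    using m unfolding matchings_on_def by auto
  have "x \<in> S - {i, k} \<and> y \<in> S - {i, k} \<and> x < y" if "(x, y) \<in> m - {(i, k)}" for x y
    using that matchings_onD[OF m, of x y] matchings_on_unique[OF m, of "(x, y)" "(i, k)"] ik by auto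
  then have "m - {(i, k)} \<subseteq> {(x, y). x \<in> S - {i, k} \<and> y \<in> S - {i, k} \<and> x < y}"
    by blast
  moreover have "\<exists>!p. p \<in> m - {(i, k)} \<and> (v = fst p \<or> v = snd p)" if v: "v \<in> S - {i, k}" for v
  proof -
    have "(p \<in> m - {(i, k)} \<and> (v = fst p \<or> v = snd p)) \<longleftrightarrow> (p \<in> m \<and> (v = fst p \<or> v = snd p))" for p
      using v by auto
    then show ?thesis using m2[of v] v by simp
  qed
  ultimately show ?thesis unfolding matchings_on_def by simp
qed

lemma sum_matchings_containing:
  assumes S: "finite S" and ik: "i \<in> S" "k \<in> S" "i < k"
  shows "(\<Sum>m | m \<in> matchings_on S \<and> (i, k) \<in> m. matching_term a m) =
    (-1) ^ card {v \<in> S. i < v \<and> v < k} * a i k * pfaffian a (S - {i, k})"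
proof -
  let ?c = "card {v \<in> S. i < v \<and> v < k}"
  have "(\<Sum>m | m \<in> matchings_on S \<and> (i, k) \<in> m. matching_term a m) =
        (\<Sum>m\<in>matchings_on (S - {i, k}). matching_term a (insert (i, k) m))"
  proof (rule sum.reindex_bij_witness[of _ "insert (i, k)" "\<lambda>m. m - {(i, k)}"])
    fix m assume m: "m \<in> matchings_on (S - {i, k})"
    have "(i, k) \<notin> m" using matchings_onD(1)[OF m, of i k] by auto
    then show "insert (i, k) m - {(i, k)} = m" by simp
    show "insert (i, k) m \<in> {m. m \<in> matchings_on S \<and> (i, k) \<in> m}"
      using matchings_on_insert[OF m ik] by simp
  qed (auto simp: insert_absorb matchings_on_remove)
  also have "\<dots> = (\<Sum>m\<in>matchings_on (S - {i, k}). (-1) ^ ?c * a i k * matching_term a m)"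
  proof (rule sum.cong[OF refl])
    fix m assume m: "m \<in> matchings_on (S - {i, k})"
    have "finite m" "(i, k) \<notin> m"
      using matchings_on_finite[OF _ m] matchings_onD(1)[OF m, of i k] S by auto
    moreover have "(-1 :: 'a) ^ crossings (insert (i, k) m) = (-1) ^ (crossings m + ?c)"
      using crossings_insert_parity[OF S m ik(3)] by (simp add: minus_one_power_iff)
    ultimately show "matching_term a (insert (i, k) m) = (-1) ^ ?c * a i k * matching_term a m"
      unfolding matching_term_def by (simp add: power_add mult_ac)
  qed
  finally show ?thesis by (simp add: pfaffian_def sum_distrib_left)
qed

text \<open>
  The expansion along an arbitrary index \<open>p\<close>, grouping the matchings by the partner \<open>k\<close> of \<open>p\<close>.
  The sign is put in the form \<open>(-1) ^ (rank T p + rank T k)\<close> in which it occurs in Laplace expansions.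
  If \<open>p < k\<close>, the ranks differ by the number of elements between \<open>p\<close> and \<open>k\<close>; if \<open>k < p\<close>, they
  differ by one more, as \<open>k\<close> itself lies below \<open>p\<close>, and this extra sign is absorbed by writing the
  entry as \<open>a p k\<close> instead of \<open>a k p\<close>.
\<close>

lemma pfaffian_insert:
  assumes T: "finite T" and p: "p \<notin> T"
    and skew: "\<And>k. k \<in> T \<Longrightarrow> a k p = - a p k"
  shows "pfaffian a (insert p T) =
    (-1) ^ rank T p * (\<Sum>k\<in>T. (-1) ^ rank T k * a p k * pfaffian a (T - {k}))"
proof -
  let ?S = "insert p T"
  let ?F = "\<lambda>k. {m \<in> matchings_on ?S. (min p k, max p k) \<in> m}"
  have cover: "matchings_on ?S = (\<Union>k\<in>T. ?F k)"
  proof (intro equalityI subsetI)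
    fix m assume m: "m \<in> matchings_on ?S"
    then obtain e where e: "e \<in> m" "p = fst e \<or> p = snd e"
      unfolding matchings_on_def by blast
    obtain x y where xy: "e = (x, y)" by fastforce
    have "x \<in> ?S" "y \<in> ?S" "x < y" using matchings_onD[OF m, of x y] e xy by auto
    then have "(x = p \<and> y \<in> T) \<or> (y = p \<and> x \<in> T)" using e(2) xy by auto
    then have "m \<in> ?F y \<and> y \<in> T \<or> m \<in> ?F x \<and> x \<in> T"
      using m e(1) xy \<open>x < y\<close> by (auto simp: min_absorb1 min_absorb2 max_absorb1 max_absorb2)
    then show "m \<in> (\<Union>k\<in>T. ?F k)" by blast
  qed auto
  have "pfaffian a ?S = sum (matching_term a) (\<Union>k\<in>T. ?F k)"
    unfolding pfaffian_def by (rule arg_cong[OF cover])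
  also have "\<dots> = (\<Sum>k\<in>T. \<Sum>m\<in>?F k. matching_term a m)"
  proof (rule sum.UNION_disjoint)
    show "\<forall>i\<in>T. \<forall>j\<in>T. i \<noteq> j \<longrightarrow> ?F i \<inter> ?F j = {}"
    proof (intro ballI impI equals0I)
      fix i j m assume ij: "i \<in> T" "j \<in> T" "i \<noteq> j" and "m \<in> ?F i \<inter> ?F j"
      then have m: "m \<in> matchings_on ?S" "(min p i, max p i) \<in> m" "(min p j, max p j) \<in> m"
        by blast+
      have "p = fst (min p k, max p k) \<or> p = snd (min p k, max p k)" for k
        by (simp add: min_def)
      from matchings_on_unique[OF m this this] have "min p i = min p j" "max p i = max p j"
        by (simp_all only: prod.inject)
      then show False using ij by (metis max_def min_def)
    qed
  qed (use T finite_matchings_on[of ?S] in auto)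
  also have "\<dots> = (\<Sum>k\<in>T. (-1) ^ rank T p * ((-1) ^ rank T k * a p k * pfaffian a (T - {k})))"
  proof (rule sum.cong[OF refl])
    fix k assume k: "k \<in> T"
    have kp: "k \<noteq> p" using k p by auto
    show "(\<Sum>m\<in>?F k. matching_term a m) =
      (-1) ^ rank T p * ((-1) ^ rank T k * a p k * pfaffian a (T - {k}))"
    proof (cases "p < k")
      case True
      have "{z \<in> T. z < k} = {z \<in> T. z < p} \<union> {v \<in> ?S. p < v \<and> v < k}"
        using True p by (auto intro: linorder_neqE_nat)
      then have "rank T k = rank T p + card {v \<in> ?S. p < v \<and> v < k}"
        unfolding rank_def using T by (simp add: card_Un_disjoint disjoint_iff)
      moreover have "?S - {p, k} = T - {k}" using p by auto
      ultimately show ?thesis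
        using sum_matchings_containing[of ?S p k a] True T k
        by (simp add: min_def max_def power_add mult_ac flip: power_mult_distrib)
    next
      case False
      then have lt: "k < p" using kp by auto
      have "{z \<in> T. z < p} = insert k ({z \<in> T. z < k} \<union> {v \<in> ?S. k < v \<and> v < p})"
        using lt p k by auto
      then have "rank T p = Suc (rank T k + card {v \<in> ?S. k < v \<and> v < p})"
        unfolding rank_def using T by (simp add: card_Un_disjoint disjoint_iff)
      moreover have "?S - {k, p} = T - {k}" using p by auto
      ultimately show ?thesis
        using sum_matchings_containing[of ?S k p a] lt T k skew[OF k]
        by (simp add: min_def max_def power_add mult_ac flip: power_mult_distrib)
    qed
  qed
  finally show ?thesis by (simp add: sum_distrib_left)
qed

section \<open>Minors of skew-symmetric matrices\<close>

text \<open>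
  The case \<open>p = q\<close> says that an even skew-symmetric determinant is the square of its Pfaffian; allowing
  \<open>p \<noteq> q\<close> is what lets the induction close, because the minors left after removing row \<open>p\<close> and
  column \<open>q\<close> are again of this form: with rows \<open>T - {k}\<close> and columns \<open>T - {y}\<close>, the odd set in common
  is \<open>T - {k, y}\<close> when \<open>k \<noteq> y\<close>, and for \<open>k = y\<close> one more element is split off. The
  entry at \<open>(p, q)\<close> drops out, since its cofactor is the skew-symmetric determinant of odd size on \<open>T\<close>.
\<close>

lemma set_minor_eq_pfaffians:
  fixes a :: "nat \<Rightarrow> nat \<Rightarrow> 'a :: comm_ring_1"
  assumes two: "\<And>x :: 'a. x + x = 0 \<Longrightarrow> x = 0"
    and skew: "\<And>i j. i \<in> U \<Longrightarrow> j \<in> U \<Longrightarrow> a i j = - a j i"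
    and "finite T" "odd (card T)" "p \<notin> T" "q \<notin> T" "insert p (insert q T) \<subseteq> U"
  shows "set_minor a (insert p T) (insert q T) = pfaffian a (insert p T) * pfaffian a (insert q T)"
  using assms(3-)
proof (induction "card T" arbitrary: T p q rule: less_induct)
  case less
  note T = less.prems(1) and odd = less.prems(2) and p = less.prems(3) and q = less.prems(4)
    and U = less.prems(5)
  let ?X = "insert p T" and ?Y = "insert q T"
  have smaller: "set_minor a (T - {k}) (T - {y}) = pfaffian a (T - {k}) * pfaffian a (T - {y})"
    if ky: "k \<in> T" "y \<in> T" for k y
  proof (cases "T = {k}")
    case True
    then show ?thesis using ky by (simp add: set_minor_def pfaffian_empty)
  next
    case False
    show ?thesis
    proof (cases "k = y")
      case True
      obtain x where x: "x \<in> T" "x \<noteq> k" using False ky by auto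
      define T' where "T' = T - {k, x}"
      have T': "T - {k} = insert x T'" "T = insert k (insert x T')" using ky x by (auto simp: T'_def)
      have c: "card T = Suc (Suc (card T'))" using T x ky T'_def by (subst T'(2)) auto
      show ?thesis
        unfolding True[symmetric] T'(1)
        by (rule less.hyps) (use c T odd U x ky in \<open>auto simp: T'_def\<close>)
    next
      case False
      define T' where "T' = T - {k, y}"
      have T': "T - {k} = insert y T'" "T - {y} = insert k T'" "T = insert k (insert y T')"
        using ky False by (auto simp: T'_def)
      have c: "card T = Suc (Suc (card T'))" using T ky False T'_def by (subst T'(3)) auto
      show ?thesis
        unfolding T'(1,2)
        by (rule less.hyps) (use c T odd U ky in \<open>auto simp: T'_def\<close>)
    qed
  qed
  have zero: "set_minor a T T = 0"
    by (rule set_minor_skew_odd[OF two T odd skew]) (use U in auto)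
  have rank_p: "rank ?X p = rank T p"
    unfolding rank_def by (rule arg_cong[where f = card]) auto
  (* In the insertion of q into the columns, exactly one of the ranks of q and y is affected by
     the other, whichever of them is larger. This gives the minus sign, which later cancels
     against a k q = - a q k. *)
  have sign: "(-1 :: 'a) ^ (rank T p + rank ?Y y) * (-1) ^ (rank T k + rank (?Y - {y}) q)
      = - ((-1) ^ (rank T p + rank T y) * (-1) ^ (rank T q + rank T k))"
    if y: "y \<in> T" for y k
  proof (cases "q < y")
    case True
    have "{z \<in> ?Y. z < y} = insert q {z \<in> T. z < y}" using True by auto
    then have "rank ?Y y = Suc (rank T y)" unfolding rank_def using T q by simp
    moreover have "rank (?Y - {y}) q = rank T q"
      unfolding rank_def using True by (intro arg_cong[where f = card]) auto
    ultimately show ?thesis by (simp add: power_add mult_ac)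
  next
    case False
    then have lt: "y < q" using y q by (metis linorder_neqE_nat)
    have "{z \<in> ?Y. z < y} = {z \<in> T. z < y}" using lt by auto
    then have "rank ?Y y = rank T y" unfolding rank_def by simp
    moreover have "{z \<in> T. z < q} = insert y {z \<in> ?Y - {y}. z < q}" using lt y by auto
    then have "rank T q = Suc (rank (?Y - {y}) q)" unfolding rank_def using T by simp
    ultimately show ?thesis by (simp add: power_add mult_ac)
  qed
  have inner: "set_minor a T (?Y - {y}) = (\<Sum>k\<in>T. (-1) ^ (rank T k + rank (?Y - {y}) q) * a k q
      * (pfaffian a (T - {k}) * pfaffian a (T - {y})))" if y: "y \<in> T" for y
  proof -
    have "?Y - {y} - {q} = T - {y}" using q by auto
    moreover have "card T = card (?Y - {y})" using T y q by (simp add: card_Diff_singleton card_gt_0_iff)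
    ultimately show ?thesis
      using set_minor_expand_column[of T "?Y - {y}" q a] T y q smaller
      by auto
  qed
  have "set_minor a ?X ?Y =
    (\<Sum>y\<in>?Y. (-1) ^ (rank ?X p + rank ?Y y) * a p y * set_minor a (?X - {p}) (?Y - {y}))"
    by (rule set_minor_expand_row) (use T p q in auto)
  also have "\<dots> = (\<Sum>y\<in>T. (-1) ^ (rank T p + rank ?Y y) * a p y * set_minor a T (?Y - {y}))"
    using T p q zero by (simp add: rank_p)
  also have "\<dots> = (\<Sum>y\<in>T. \<Sum>k\<in>T. ((-1) ^ (rank T p + rank T y) * a p y * pfaffian a (T - {y}))
        * ((-1) ^ (rank T q + rank T k) * a q k * pfaffian a (T - {k})))"
  proof (rule sum.cong[OF refl])
    fix y assume y: "y \<in> T"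
    have "(-1) ^ (rank T p + rank ?Y y) * a p y * set_minor a T (?Y - {y}) =
      (\<Sum>k\<in>T. ((-1) ^ (rank T p + rank ?Y y) * (-1) ^ (rank T k + rank (?Y - {y}) q)) * a k q
        * (a p y * pfaffian a (T - {k}) * pfaffian a (T - {y})))"
      unfolding inner[OF y] by (simp add: sum_distrib_left mult_ac)
    also have "\<dots> = (\<Sum>k\<in>T. ((-1) ^ (rank T p + rank T y) * a p y * pfaffian a (T - {y}))
        * ((-1) ^ (rank T q + rank T k) * a q k * pfaffian a (T - {k})))"
    proof (rule sum.cong[OF refl])
      fix k assume "k \<in> T"
      then have "a k q = - a q k" using skew[of k q] U by auto
      then show "((-1) ^ (rank T p + rank ?Y y) * (-1) ^ (rank T k + rank (?Y - {y}) q)) * a k q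
        * (a p y * pfaffian a (T - {k}) * pfaffian a (T - {y})) =
        ((-1) ^ (rank T p + rank T y) * a p y * pfaffian a (T - {y}))
        * ((-1) ^ (rank T q + rank T k) * a q k * pfaffian a (T - {k}))"
        unfolding sign[OF y] by (simp add: mult_ac)
    qed
    finally show "(-1) ^ (rank T p + rank ?Y y) * a p y * set_minor a T (?Y - {y}) = \<dots>" .
  qed
  also have "\<dots> = (\<Sum>y\<in>T. (-1) ^ (rank T p + rank T y) * a p y * pfaffian a (T - {y}))
        * (\<Sum>k\<in>T. (-1) ^ (rank T q + rank T k) * a q k * pfaffian a (T - {k}))"
    by (simp add: sum_product)
  also have "\<dots> = pfaffian a ?X * pfaffian a ?Y"
  proof -
    have "pfaffian a (insert r T) = (\<Sum>k\<in>T. (-1) ^ (rank T r + rank T k) * a r k * pfaffian a (T - {k}))"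
      if "r \<notin> T" "insert r T \<subseteq> U" for r
    proof -
      have "\<And>k. k \<in> T \<Longrightarrow> a k r = - a r k" using skew that by blast
      from pfaffian_insert[OF T that(1), of a, OF this] show ?thesis
        by (simp add: sum_distrib_left power_add mult_ac)
    qed
    then show ?thesis using p q U by simp
  qed
  finally show ?case .
qed

section \<open>The rank-two perturbation\<close>

definition row_e :: "(nat \<Rightarrow> nat \<Rightarrow> 'a) \<Rightarrow> nat \<Rightarrow> 'a :: comm_ring_1" where
  "row_e a k = (if even k then a 1 k else 0)"

definition row_o :: "(nat \<Rightarrow> nat \<Rightarrow> 'a) \<Rightarrow> nat \<Rightarrow> 'a :: comm_ring_1" where
  "row_o a k = (if odd k then a 1 k else 0)"

text \<open>For \<open>c = 1\<close> and \<open>c = -1\<close> these are the matrices \<open>G\<close> and \<open>H\<close> of the introduction. The indices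
  \<open>0\<close> and \<open>1\<close> are those of the border; the index \<open>1\<close> of \<open>A\<close> occurs only through its row.\<close>

definition bordered :: "'a \<Rightarrow> (nat \<Rightarrow> nat \<Rightarrow> 'a) \<Rightarrow> nat \<Rightarrow> nat \<Rightarrow> 'a :: comm_ring_1" where
  "bordered c a i j =
     (if i = 0 then (if j = 0 then 0 else if j = 1 then -1 else row_e a j)
      else if i = 1 then (if j = 0 then c else if j = 1 then 0 else row_o a j)
      else (if j = 0 then - row_e a i else if j = 1 then - row_o a i else a i j))"

lemma C_entry_eq:
  "C_entry a i j = a i j - row_o a i * row_e a j - row_e a i * row_o a j"
  by (auto simp: C_entry_def row_e_def row_o_def)

lemma sum_atLeast0_first_two:
  fixes f :: "nat \<Rightarrow> 'a :: comm_monoid_add"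
  assumes "n \<ge> 2"
  shows "sum f {0..<Suc n} = f 0 + (f 1 + sum f {2..<Suc n})"
  using assms by (simp add: sum.atLeast_Suc_lessThan numeral_2_eq_2 del: sum.op_ivl_Suc)

text \<open>
  Subtracting suitable multiples of the two border rows from the row \<open>i \<in> S\<close> clears its border entries
  and turns the rest into row \<open>i\<close> of \<open>C\<close>. What remains is block triangular with the
  diagonal blocks \<open>[0, -1; -1, 0]\<close>, of determinant \<open>-1\<close>, and \<open>C\<close>.
\<close>

lemma set_minor_bordered:
  assumes n: "n \<ge> 2"
  shows "set_minor (bordered (-1) a) {0..n} {0..n} = - det (C_mat n a)"
proof -
  define reduced where "reduced i j = (if i < 2 then bordered (-1) a i j
    else if j < 2 then 0 else C_entry a i j)" for i j
  (* Left multiplication by the unitriangular matrix L performs the row operations. *)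
  define L where "L = mat (Suc n) (Suc n) (\<lambda>(r, c). if r = c then 1
    else if r < 2 then 0 else if c = 0 then - row_o a r else if c = 1 then - row_e a r else 0)"
  define H where "H = mat (Suc n) (Suc n) (\<lambda>(r, c). bordered (-1) a r c)"
  define K where "K = mat (Suc n) (Suc n) (\<lambda>(r, c). reduced r c)"
  have list: "sorted_list_of_set {0..n} ! r = r" if "r < Suc n" for r
  proof -
    have "sorted_list_of_set {0..n} = [0..<Suc n]"
      by (simp only: sorted_list_of_set_range atLeastLessThanSuc_atLeastAtMost[symmetric])
    then show ?thesis using that by (simp del: upt_Suc)
  qed
  have minor: "set_minor f {0..n} {0..n} = det (mat (Suc n) (Suc n) (\<lambda>(r, c). f r c))" for f :: "nat \<Rightarrow> nat \<Rightarrow> 'a"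
    unfolding set_minor_def by (rule arg_cong[where f = det]) (auto simp: list simp del: sorted_list_of_set_range intro!: eq_matI)
  have LH: "L * H = K"
  proof (rule eq_matI)
    fix r c assume "r < dim_row K" "c < dim_col K"
    then have rc: "r < Suc n" "c < Suc n" by (auto simp: K_def)
    have "(L * H) $$ (r, c) = (\<Sum>k\<in>{0..<Suc n}. L $$ (r, k) * H $$ (k, c))"
      using rc by (simp add: L_def H_def scalar_prod_def)
    also have "\<dots> = K $$ (r, c)"
    proof (cases "r < 2")
      case True
      have "(\<Sum>k\<in>{0..<Suc n}. L $$ (r, k) * H $$ (k, c)) =
        (\<Sum>k\<in>{0..<Suc n}. if k = r then H $$ (r, c) else 0)"
        using rc True by (intro sum.cong) (auto simp: L_def)
      then show ?thesis using True rc by (simp add: H_def K_def reduced_def)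
    next
      case False
      have "(\<Sum>k\<in>{2..<Suc n}. L $$ (r, k) * H $$ (k, c)) =
        (\<Sum>k\<in>{2..<Suc n}. if k = r then H $$ (r, c) else 0)"
        using rc False by (intro sum.cong) (auto simp: L_def)
      also have "\<dots> = H $$ (r, c)" using False rc by simp
      finally have "(\<Sum>k\<in>{0..<Suc n}. L $$ (r, k) * H $$ (k, c)) =
        L $$ (r, 0) * H $$ (0, c) + (L $$ (r, 1) * H $$ (1, c) + H $$ (r, c))"
        using n by (simp only: sum_atLeast0_first_two)
      then show ?thesis using False rc n
        by (auto simp: L_def H_def K_def reduced_def bordered_def C_entry_eq)
    qed
    finally show "(L * H) $$ (r, c) = K $$ (r, c)" .
  qed (auto simp: L_def H_def K_def)
  have carrier: "L \<in> carrier_mat (Suc n) (Suc n)" "H \<in> carrier_mat (Suc n) (Suc n)"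
    by (auto simp: L_def H_def)
  have "det L = prod_list (diag_mat L)"
    by (rule det_lower_triangular[OF _ carrier(1)]) (auto simp: L_def)
  also have "\<dots> = 1" by (simp add: prod_list_diag_prod L_def)
  finally have "det H = det K"
    using det_mult[OF carrier] LH by simp
  then have step: "set_minor (bordered (-1) a) {0..n} {0..n} = set_minor reduced {0..n} {0..n}"
    by (simp add: minor H_def K_def)
  have col0: "set_minor reduced {0..n} {0..n} = set_minor reduced ({0..n} - {1}) ({0..n} - {0})"
  proof -
    have "set_minor reduced {0..n} {0..n} = (\<Sum>x\<in>{0..n}. (-1) ^ (rank {0..n} x + rank {0..n} 0)
        * reduced x 0 * set_minor reduced ({0..n} - {x}) ({0..n} - {0}))"
      by (rule set_minor_expand_column) auto
    also have "\<dots> = (\<Sum>x\<in>{1}. (-1) ^ (rank {0..n} x + rank {0..n} 0)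
        * reduced x 0 * set_minor reduced ({0..n} - {x}) ({0..n} - {0}))"
      using n by (intro sum.mono_neutral_right) (auto simp: reduced_def bordered_def)
    also have "rank {0..n} 1 = 1"
    proof -
      have "{z \<in> {0..n}. z < 1} = {0}" by auto
      then show ?thesis by (simp add: rank_def)
    qed
    moreover have "rank {0..n} 0 = 0" by (simp add: rank_def)
    ultimately show ?thesis using n by (simp add: reduced_def bordered_def)
  qed
  have sets: "{0..n} - {1} = insert 0 {2..n}" "{0..n} - {0} = insert 1 {2..n}"
    using n by auto
  have col1: "set_minor reduced ({0..n} - {1}) ({0..n} - {0}) = - set_minor reduced {2..n} {2..n}"
  proof -
    let ?X = "insert 0 {2..n}" and ?Y = "insert 1 {2..n}"
    have "set_minor reduced ?X ?Y = (\<Sum>x\<in>?X. (-1) ^ (rank ?X x + rank ?Y 1)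
        * reduced x 1 * set_minor reduced (?X - {x}) (?Y - {1}))"
      by (rule set_minor_expand_column) auto
    also have "\<dots> = (\<Sum>x\<in>{0}. (-1) ^ (rank ?X x + rank ?Y 1)
        * reduced x 1 * set_minor reduced (?X - {x}) (?Y - {1}))"
      by (intro sum.mono_neutral_right) (auto simp: reduced_def)
    also have "rank ?X 0 = 0" by (simp add: rank_def)
    moreover have "rank ?Y 1 = 0"
    proof -
      have "{z \<in> ?Y. z < 1} = {}" by auto
      then show ?thesis by (simp only: rank_def card.empty)
    qed
    ultimately show ?thesis unfolding sets by (simp add: reduced_def bordered_def)
  qed
  have "set_minor reduced {2..n} {2..n} = det (C_mat n a)"
  proof -
    have "sorted_list_of_set {2..n} ! r = r + 2" if "r < n - 1" for r
    proof -
      have "sorted_list_of_set {2..n} = [2..<Suc n]"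
        by (simp only: sorted_list_of_set_range atLeastLessThanSuc_atLeastAtMost[symmetric])
      then show ?thesis using that by (simp del: upt_Suc)
    qed
    then show ?thesis
      unfolding set_minor_def C_mat_def
      by (intro arg_cong[where f = det]) (use n in \<open>auto simp: reduced_def intro!: eq_matI\<close>)
  qed
  then show ?thesis using step col0 col1 by simp
qed

text \<open>The rank of \<open>k\<close> in \<open>{2..n}\<close> is \<open>k - 2\<close>, so the sign is just \<open>(-1) ^ k\<close>.\<close>

lemma pfaffian_bordered:
  assumes "p = 0 \<or> p = 1"
  shows "pfaffian (bordered c a) (insert p {2..n}) =
    (\<Sum>k\<in>{2..n}. (-1) ^ k * bordered c a p k * pfaffian a ({2..n} - {k}))"
proof -
  have "pfaffian (bordered c a) (insert p {2..n}) = (-1) ^ rank {2..n} p *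
    (\<Sum>k\<in>{2..n}. (-1) ^ rank {2..n} k * bordered c a p k * pfaffian (bordered c a) ({2..n} - {k}))"
    by (rule pfaffian_insert) (use assms in \<open>auto simp: bordered_def\<close>)
  also have "rank {2..n} p = 0" using assms by (auto simp: rank_def)
  also have "(-1) ^ 0 * (\<Sum>k\<in>{2..n}. (-1) ^ rank {2..n} k * bordered c a p k * pfaffian (bordered c a) ({2..n} - {k}))
    = (\<Sum>k\<in>{2..n}. (-1) ^ k * bordered c a p k * pfaffian a ({2..n} - {k}))"
    unfolding power_0 mult_1
  proof (rule sum.cong[OF refl])
    fix k assume k: "k \<in> {2..n}"
    have "{z \<in> {2..n}. z < k} = {2..<k}" using k by auto
    then have "rank {2..n} k = k - 2" by (simp add: rank_def)
    then have "(-1 :: 'a) ^ rank {2..n} k = (-1) ^ k"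
      using k by (auto simp: minus_one_power_iff)
    moreover have "pfaffian (bordered c a) ({2..n} - {k}) = pfaffian a ({2..n} - {k})"
      by (rule pfaffian_cong) (auto simp: bordered_def)
    ultimately show "(-1) ^ rank {2..n} k * bordered c a p k * pfaffian (bordered c a) ({2..n} - {k})
      = (-1) ^ k * bordered c a p k * pfaffian a ({2..n} - {k})" by simp
  qed
  finally show ?thesis .
qed

text \<open>Restricting the partner of \<open>1\<close> amounts to masking the first row: this identifies \<open>Pf_e\<close> and \<open>Pf_o\<close>
  with the Pfaffians of the bordered matrix.\<close>

lemma sum_matchings_partner_of_1:
  assumes n: "n \<ge> 2"
  shows "(\<Sum>m | m \<in> perfect_matchings n \<and> (\<exists>k. (1, k) \<in> m \<and> P k). matching_term a m) =
    (\<Sum>k\<in>{2..n}. (-1) ^ k * (if P k then a 1 k else 0) * pfaffian a ({2..n} - {k}))"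
proof -
  have pm: "perfect_matchings n = matchings_on {1..n}"
    unfolding perfect_matchings_def matchings_on_def by simp
  let ?F = "\<lambda>k. {m. m \<in> matchings_on {1..n} \<and> (1, k) \<in> m}"
  have cover: "{m. m \<in> perfect_matchings n \<and> (\<exists>k. (1, k) \<in> m \<and> P k)} = (\<Union>k\<in>{k\<in>{2..n}. P k}. ?F k)"
  proof (intro equalityI subsetI)
    fix m assume "m \<in> {m. m \<in> perfect_matchings n \<and> (\<exists>k. (1, k) \<in> m \<and> P k)}"
    then obtain k where k: "m \<in> matchings_on {1..n}" "(1, k) \<in> m" "P k" unfolding pm by blast
    then have "k \<in> {2..n}" using matchings_onD[OF k(1,2)] by auto
    then show "m \<in> (\<Union>k\<in>{k\<in>{2..n}. P k}. ?F k)" using k by blast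
  next
    fix m assume "m \<in> (\<Union>k\<in>{k\<in>{2..n}. P k}. ?F k)"
    then show "m \<in> {m. m \<in> perfect_matchings n \<and> (\<exists>k. (1, k) \<in> m \<and> P k)}"
      unfolding pm by blast
  qed
  have "(\<Sum>m | m \<in> perfect_matchings n \<and> (\<exists>k. (1, k) \<in> m \<and> P k). matching_term a m) =
    (\<Sum>k\<in>{k\<in>{2..n}. P k}. \<Sum>m\<in>?F k. matching_term a m)"
    unfolding cover
  proof (rule sum.UNION_disjoint)
    show "\<forall>i\<in>{k\<in>{2..n}. P k}. \<forall>j\<in>{k\<in>{2..n}. P k}. i \<noteq> j \<longrightarrow> ?F i \<inter> ?F j = {}"
    proof (intro ballI impI equals0I)
      fix i j m assume "i \<noteq> j" and "m \<in> ?F i \<inter> ?F j"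
      then have m: "m \<in> matchings_on {1..n}" "(1, i) \<in> m" "(1, j) \<in> m" by blast+
      have "(1 :: nat, i) = (1, j)" by (rule matchings_on_unique[OF m, of 1]) simp_all
      then show False using \<open>i \<noteq> j\<close> by simp
    qed
  qed (use finite_matchings_on[of "{1..n}"] in auto)
  also have "\<dots> = (\<Sum>k\<in>{k\<in>{2..n}. P k}. (-1) ^ k * a 1 k * pfaffian a ({2..n} - {k}))"
  proof (rule sum.cong[OF refl])
    fix k assume "k \<in> {k\<in>{2..n}. P k}"
    then have k: "k \<in> {2..n}" by auto
    have "{v \<in> {1..n}. 1 < v \<and> v < k} = {2..<k}" using k by auto
    then have "(-1 :: 'a) ^ card {v \<in> {1..n}. 1 < v \<and> v < k} = (-1) ^ k"
      using k by (auto simp: minus_one_power_iff)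
    moreover have "{1..n} - {1, k} = {2..n} - {k}" by auto
    ultimately show "(\<Sum>m\<in>?F k. matching_term a m) = (-1) ^ k * a 1 k * pfaffian a ({2..n} - {k})"
      using sum_matchings_containing[of "{1..n}" 1 k a] k by simp
  qed
  also have "\<dots> = (\<Sum>k\<in>{2..n}. if P k then (-1) ^ k * a 1 k * pfaffian a ({2..n} - {k}) else 0)"
    by (rule sum.inter_filter) simp
  also have "\<dots> = (\<Sum>k\<in>{2..n}. (-1) ^ k * (if P k then a 1 k else 0) * pfaffian a ({2..n} - {k}))"
    by (intro sum.cong) auto
  finally show ?thesis .
qed

lemma two_cancel_if_contains_rat:
  assumes "\<exists>\<iota> :: rat \<Rightarrow> 'a :: comm_ring_1. inj_comm_ring_hom \<iota>" and "x + x = (0 :: 'a)"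
  shows "x = 0"
proof -
  from assms(1) obtain \<iota> :: "rat \<Rightarrow> 'a" where "inj_comm_ring_hom \<iota>" by blast
  then interpret inj_comm_ring_hom \<iota> .
  have "\<iota> (1/2) + \<iota> (1/2) = \<iota> (1/2 + 1/2)" by (simp only: hom_add)
  then have "\<iota> (1/2) + \<iota> (1/2) = 1" by simp
  then have "x = (\<iota> (1/2) + \<iota> (1/2)) * x" by simp
  also have "\<dots> = \<iota> (1/2) * (x + x)" by (simp add: algebra_simps)
  finally show ?thesis using assms(2) by simp
qed

theorem theorem7:
  fixes n :: nat and a :: "nat \<Rightarrow> nat \<Rightarrow> 'a :: comm_ring_1"
  assumes contains_rat: "\<exists>\<iota> :: rat \<Rightarrow> 'a. inj_comm_ring_hom \<iota>"
    and n: "even n" "n > 0"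
    and skew: "\<And>i j. i \<in> {1..n} \<Longrightarrow> j \<in> {1..n} \<Longrightarrow> a i j = - a j i"
  shows "det (C_mat n a) = - 2 * Pf_e n a * Pf_o n a"
proof -
  have n2: "n \<ge> 2" using n by presburger
  note two = two_cancel_if_contains_rat[OF contains_rat]
  let ?g = "bordered 1 a" and ?h = "bordered (-1) a"
  have skew_g: "?g i j = - ?g j i" if "i \<in> {0..n}" "j \<in> {0..n}" for i j
  proof (cases "i < 2 \<or> j < 2")
    case True
    then show ?thesis by (auto simp: bordered_def)
  next
    case False
    then show ?thesis using that by (auto simp: bordered_def intro: skew)
  qed
  have "set_minor ?g {0..n} {0..n} = 0"
    by (rule set_minor_skew_odd[OF two _ _ skew_g]) (use n in auto)
  (* The two matrices differ only in row 1, and there only at column 0. *)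
  moreover have "set_minor ?h {0..n} {0..n} - set_minor ?g {0..n} {0..n} =
    (\<Sum>y\<in>{0..n}. (-1) ^ (rank {0..n} 1 + rank {0..n} y) * (?h 1 y - ?g 1 y)
      * set_minor ?g ({0..n} - {1}) ({0..n} - {y}))"
    by (rule set_minor_change_row) (use n2 in \<open>auto simp: bordered_def\<close>)
  moreover have "\<dots> = (\<Sum>y\<in>{0}. (-1) ^ (rank {0..n} 1 + rank {0..n} y) * (?h 1 y - ?g 1 y)
      * set_minor ?g ({0..n} - {1}) ({0..n} - {y}))"
    by (intro sum.mono_neutral_right) (auto simp: bordered_def)
  moreover have "rank {0..n} 1 = 1"
  proof -
    have "{z \<in> {0..n}. z < 1} = {0}" by auto
    then show ?thesis by (simp add: rank_def)
  qed
  moreover have "rank {0..n} 0 = 0" by (simp add: rank_def)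
  moreover have "{0..n} - {1} = insert 0 {2..n}" "{0..n} - {0} = insert 1 {2..n}"
    using n2 by auto
  moreover have "set_minor ?g (insert 0 {2..n}) (insert 1 {2..n}) =
      pfaffian ?g (insert 0 {2..n}) * pfaffian ?g (insert 1 {2..n})"
    by (rule set_minor_eq_pfaffians[where U = "{0..n}", OF two skew_g]) (use n n2 in auto)
  moreover have "pfaffian ?g (insert 0 {2..n}) = Pf_e n a"
    unfolding Pf_e_def sum_matchings_partner_of_1[OF n2] pfaffian_bordered[OF disjI1[OF refl]]
    by (intro sum.cong) (auto simp: bordered_def row_e_def)
  moreover have "pfaffian ?g (insert 1 {2..n}) = Pf_o n a"
    unfolding Pf_o_def sum_matchings_partner_of_1[OF n2] pfaffian_bordered[OF disjI2[OF refl]]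
    by (intro sum.cong) (auto simp: bordered_def row_o_def)
  ultimately have "set_minor ?h {0..n} {0..n} = 2 * (Pf_e n a * Pf_o n a)"
    by (simp add: bordered_def)
  then have "- det (C_mat n a) = 2 * (Pf_e n a * Pf_o n a)"
    unfolding set_minor_bordered[OF n2] .
  then have "det (C_mat n a) = - (2 * (Pf_e n a * Pf_o n a))"
    by (metis minus_minus)
  then show ?thesis by (simp only: mult_minus_left mult.assoc)
qed

end
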